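(* Let $G=(V,E,w)$ be a finite weighted graph with weight function $w\colon E\to\mathbb R$ and let $0=r_0<r_1<\dots<r_m$. For any vertex $v\in V$, the persistent link complex of $v$ in the filtration of clique complexes $\mathrm{Clq}(G_{r_0})\hookrightarrow\cdots\hookrightarrow\mathrm{Clq}(G_{r_m})$ is equal to the persistent clique complex of the induced neighborhood subgraphs: $$\mathrm{Lk}_{\mathrm{Clq}(G)}(v)=\mathrm{Clq}(G_\bullet[N_\bullet(v)]),$$ that is, for each index $i$, $\mathrm{Lk}_{\mathrm{Clq}(G_i)}(v)=\mathrm{Clq}(G_i[N_i(v)])$, and the transition maps (inclusions) coincide.
   Context: For $r\in\mathbb R$, $G_r=(V,E_r)$ with $E_r=\{e\in E\mid w(e)\le r\}$; write $G_i=G_{r_i}$, $E_i=E_{r_i}$. $\mathrm{Clq}(H)$ is the clique (flag) complex of a graph $H$: its simplices are the nonempty finite sets of pairwise adjacent vertices. $N_i(v)=\{u\in V\mid (u,v)\in E_i\}$ and $G_i[N_i(v)]$ is the subgraph of $G_i$ induced by $N_i(v)$. For a simplicial complex $K$, $\mathrm{Lk}_K(v)=\{\sigma\in K\mid v\notin\sigma,\ \sigma\cup\{v\}\in K\}$; the persistent link complex has $\mathrm{Lk}_{\mathrm{Clq}(G_i)}(v)$ at index $i$ with inclusions as transition maps. Graphs are undirected without loops. *)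

theory Defs
  imports Complex_Main "HOL-Library.FuncSet"
begin

section \<open>Finite simple graphs\<close>

text \<open>Edges are two-element vertex sets, so a weight function on them is
  a function of the undirected edge; its values outside the edge set are never used.\<close>

record 'a ugraph =
  verts :: "'a set"
  edges :: "'a set set"

definition finite_simple_graph :: "'a ugraph \<Rightarrow> bool" where
  "finite_simple_graph G \<longleftrightarrow>
     finite (verts G) \<and>
     (\<forall>e\<in>edges G. \<exists>x\<in>verts G. \<exists>y\<in>verts G. x \<noteq> y \<and> e = {x, y})"

definition sublevel_graph :: "'a ugraph \<Rightarrow> ('a set \<Rightarrow> real) \<Rightarrow> real \<Rightarrow> 'a ugraph" where
  "sublevel_graph G w r = \<lparr>verts = verts G, edges = {e \<in> edges G. w e \<le> r}\<rparr>"

definition nbhd :: "'a ugraph \<Rightarrow> 'a \<Rightarrow> 'a set" where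
  "nbhd G v = {u \<in> verts G. {u, v} \<in> edges G}"

definition induced_subgraph :: "'a ugraph \<Rightarrow> 'a set \<Rightarrow> 'a ugraph" where
  "induced_subgraph G S = \<lparr>verts = verts G \<inter> S, edges = {e \<in> edges G. e \<subseteq> S}\<rparr>"


section \<open>Abstract simplicial complexes\<close>

text \<open>A complex is the set of its nonempty finite simplices; the empty simplex is
  never a member.  The vertex set of \<open>K\<close> is \<open>\<Union>K\<close>.\<close>

definition abstract_complex :: "'a set set \<Rightarrow> bool" where
  "abstract_complex K \<longleftrightarrow>
     (\<forall>\<sigma>\<in>K. finite \<sigma> \<and> \<sigma> \<noteq> {} \<and> (\<forall>\<tau>. \<tau> \<subseteq> \<sigma> \<and> \<tau> \<noteq> {} \<longrightarrow> \<tau> \<in> K))"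

definition Clq :: "'a ugraph \<Rightarrow> 'a set set" where
  "Clq H = {\<sigma>. \<sigma> \<noteq> {} \<and> finite \<sigma> \<and> \<sigma> \<subseteq> verts H \<and>
                (\<forall>x\<in>\<sigma>. \<forall>y\<in>\<sigma>. x \<noteq> y \<longrightarrow> {x, y} \<in> edges H)}"

definition Lk :: "'a set set \<Rightarrow> 'a \<Rightarrow> 'a set set" where
  "Lk K v = {\<sigma> \<in> K. v \<notin> \<sigma> \<and> \<sigma> \<union> {v} \<in> K}"

text \<open>A simplicial map is given by its vertex map, taken extensional so that equality
  of simplicial maps is equality of functions.\<close>

definition simplicial_map :: "'a set set \<Rightarrow> 'a set set \<Rightarrow> ('a \<Rightarrow> 'a) \<Rightarrow> bool" where
  "simplicial_map K L f \<longleftrightarrow> f \<in> extensional (\<Union>K) \<and> (\<forall>\<sigma>\<in>K. f ` \<sigma> \<in> L)"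


section \<open>Persistent complexes indexed by \<open>0, \<dots>, m\<close>\<close>

record 'a pcomplex =
  level :: "nat \<Rightarrow> 'a set set"
  transition :: "nat \<Rightarrow> nat \<Rightarrow> 'a \<Rightarrow> 'a"

definition persistent_complex :: "nat \<Rightarrow> 'a pcomplex \<Rightarrow> bool" where
  "persistent_complex m P \<longleftrightarrow>
     (\<forall>i\<le>m. abstract_complex (level P i)) \<and>
     (\<forall>i j. i \<le> j \<and> j \<le> m \<longrightarrow>
        simplicial_map (level P i) (level P j) (transition P i j)) \<and>
     (\<forall>i\<le>m. transition P i i = restrict id (\<Union>(level P i))) \<and>
     (\<forall>i j k. i \<le> j \<and> j \<le> k \<and> k \<le> m \<longrightarrow>
        transition P i k = compose (\<Union>(level P i)) (transition P j k) (transition P i j))"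

text \<open>The complexes \<open>K 0, \<dots>, K m\<close> with inclusions as transition maps.  Nothing here
  forces \<open>K i \<subseteq> K j\<close>: that is contained in the claim that the result satisfies
  \<open>persistent_complex m\<close>.  Data at indices outside \<open>0, \<dots>, m\<close> are set to \<open>undefined\<close>, so that
  equality of records compares exactly the levels and transition maps in range.\<close>

definition inclusion_persistence :: "nat \<Rightarrow> (nat \<Rightarrow> 'a set set) \<Rightarrow> 'a pcomplex" where
  "inclusion_persistence m K =
     \<lparr>level = restrict K {..m},
      transition = (\<lambda>i j. if i \<le> j \<and> j \<le> m then restrict id (\<Union>(K i)) else undefined)\<rparr>"

definition persistent_link :: "nat \<Rightarrow> (nat \<Rightarrow> 'a set set) \<Rightarrow> 'a \<Rightarrow> 'a pcomplex" where
  "persistent_link m K v = inclusion_persistence m (\<lambda>i. Lk (K i) v)"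

definition persistent_clique :: "nat \<Rightarrow> (nat \<Rightarrow> 'a ugraph) \<Rightarrow> 'a pcomplex" where
  "persistent_clique m H = inclusion_persistence m (\<lambda>i. Clq (H i))"

end

theory Submission
  imports Defs
begin

text \<open>In a loopless graph, a set avoiding \<open>v\<close> stays a clique after adding
  \<open>v\<close> exactly when it is a clique all of whose vertices are adjacent to
  \<open>v\<close>; this gives the levelwise equality \<open>Lk_Clq_eq_Clq_nbhd\<close>. Inclusion
  maps are determined by the levels, so the persistent objects then agree as well. That they really
  are persistent complexes follows from monotonicity of sublevel graphs, cliques and links, through
  \<open>persistent_complex_inclusion_persistence\<close>.\<close>

lemma abstract_complex_Clq: "abstract_complex (Clq H)"
  unfolding abstract_complex_def Clq_def
  by (auto intro: finite_subset)

lemma Clq_mono: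
  assumes "verts H \<subseteq> verts H'" and "edges H \<subseteq> edges H'"
  shows "Clq H \<subseteq> Clq H'"
  using assms unfolding Clq_def by blast

lemma Lk_mono: "K \<subseteq> K' \<Longrightarrow> Lk K v \<subseteq> Lk K' v"
  unfolding Lk_def by blast

lemma sublevel_graph_mono:
  assumes "a \<le> b"
  shows "verts (sublevel_graph G w a) \<subseteq> verts (sublevel_graph G w b)"
    and "edges (sublevel_graph G w a) \<subseteq> edges (sublevel_graph G w b)"
  using assms by (auto simp: sublevel_graph_def)

lemma Lk_Clq_eq_Clq_nbhd:
  assumes v: "v \<in> verts H" and loopless: "{v} \<notin> edges H"
  shows "Lk (Clq H) v = Clq (induced_subgraph H (nbhd H v))"
proof (intro equalityI subsetI)
  fix \<sigma> assume "\<sigma> \<in> Lk (Clq H) v"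
  then have \<sigma>: "\<sigma> \<in> Clq H" "v \<notin> \<sigma>" "\<sigma> \<union> {v} \<in> Clq H"
    by (auto simp: Lk_def)
  then have "\<sigma> \<subseteq> nbhd H v"
    by (auto simp: Clq_def nbhd_def)
  with \<sigma>(1) show "\<sigma> \<in> Clq (induced_subgraph H (nbhd H v))"
    by (auto simp: Clq_def induced_subgraph_def)
next
  fix \<sigma> assume "\<sigma> \<in> Clq (induced_subgraph H (nbhd H v))"
  then have \<sigma>: "\<sigma> \<in> Clq H" and nb: "\<sigma> \<subseteq> nbhd H v"
    by (auto simp: Clq_def induced_subgraph_def)
  \<comment> \<open>For \<open>u = v\<close> the edge \<open>{u, v}\<close> collapses to
    \<open>{v}\<close>, so looplessness keeps \<open>v\<close> out of its own neighborhood.\<close>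
  from nb loopless have "v \<notin> \<sigma>"
    by (auto simp: nbhd_def)
  moreover from nb have "{x, v} \<in> edges H" "{v, x} \<in> edges H" if "x \<in> \<sigma>" for x
    using that by (auto simp: nbhd_def insert_commute)
  with \<sigma> v have "\<sigma> \<union> {v} \<in> Clq H"
    by (auto simp: Clq_def)
  ultimately show "\<sigma> \<in> Lk (Clq H) v"
    using \<sigma> by (simp add: Lk_def)
qed

text \<open>Each transition is the identity cut down to the vertices of its source, so nesting of
  the levels is all that simpliciality and functoriality require.\<close>

lemma persistent_complex_inclusion_persistence:
  assumes "\<And>i. i \<le> m \<Longrightarrow> abstract_complex (K i)"
    and mono: "\<And>i j. i \<le> j \<Longrightarrow> j \<le> m \<Longrightarrow> K i \<subseteq> K j"
  shows "persistent_complex m (inclusion_persistence m K)"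
proof -
  have "restrict id (\<Union>(K i)) ` \<sigma> = \<sigma>" if "\<sigma> \<in> K i" for \<sigma> i
    using that by force
  then have "simplicial_map (K i) (K j) (restrict id (\<Union>(K i)))" if "i \<le> j" "j \<le> m" for i j
    using mono[OF that] by (auto simp: simplicial_map_def)
  \<comment> \<open>Since \<open>\<Union>(K i) \<subseteq> \<Union>(K j)\<close>, the second map is
    never evaluated where it is \<open>undefined\<close>.\<close>
  moreover have "restrict id (\<Union>(K i)) =
      compose (\<Union>(K i)) (restrict id (\<Union>(K j))) (restrict id (\<Union>(K i)))"
    if "i \<le> j" "j \<le> m" for i j
    using mono[OF that] by (auto simp: compose_def fun_eq_iff)
  ultimately show ?thesis
    using assms(1) by (simp add: persistent_complex_def inclusion_persistence_def)
qed

theorem proposition4p3: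
  fixes G :: "'a ugraph" and w :: "'a set \<Rightarrow> real"
    and r :: "nat \<Rightarrow> real" and m :: nat and v :: 'a
    and Gr :: "nat \<Rightarrow> 'a ugraph" and L C :: "'a pcomplex"
  assumes "finite_simple_graph G"
    and "r 0 = 0" and "strict_mono_on {..m} r"
    and "v \<in> verts G"
  defines "Gr \<equiv> \<lambda>i. sublevel_graph G w (r i)"
  defines "L \<equiv> persistent_link m (\<lambda>i. Clq (Gr i)) v"
    and "C \<equiv> persistent_clique m (\<lambda>i. induced_subgraph (Gr i) (nbhd (Gr i) v))"
  shows "persistent_complex m L \<and> persistent_complex m C \<and> L = C \<and>
    (\<forall>i\<le>m. Lk (Clq (Gr i)) v = Clq (induced_subgraph (Gr i) (nbhd (Gr i) v))) \<and>
    (\<forall>i j. i \<le> j \<and> j \<le> m \<longrightarrow> transition L i j = transition C i j)"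
proof -
  have "{v} \<notin> edges G"
    using assms(1) by (force simp: finite_simple_graph_def)
  with \<open>v \<in> verts G\<close> have Lk: "Lk (Clq (Gr i)) v = Clq (induced_subgraph (Gr i) (nbhd (Gr i) v))" for i
    by (intro Lk_Clq_eq_Clq_nbhd) (auto simp: Gr_def sublevel_graph_def)
  \<comment> \<open>Both sides apply \<open>inclusion_persistence m\<close> to families of complexes
    that are equal at every index.\<close>
  then have LC: "L = C"
    by (simp add: L_def C_def persistent_link_def persistent_clique_def)
  have "Lk (Clq (Gr i)) v \<subseteq> Lk (Clq (Gr j)) v" if "i \<le> j" "j \<le> m" for i j
  proof -
    have "r i \<le> r j"
      using \<open>strict_mono_on {..m} r\<close> that by (auto simp: strict_mono_on_leD)
    then show ?thesis
      unfolding Gr_def by (intro Lk_mono Clq_mono sublevel_graph_mono)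
  qed
  \<comment> \<open>Nesting of the links was just shown; that each link is a complex comes from
    \<open>Lk\<close>, which identifies it with a clique complex.\<close>
  then have "persistent_complex m L"
    unfolding L_def persistent_link_def
    by (intro persistent_complex_inclusion_persistence) (simp_all add: Lk abstract_complex_Clq)
  with LC Lk show ?thesis
    by simp
qed

end
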